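(* Let $n$ be any positive integer. Then $$m_{-n}(x)=\frac{m_n(x)}{2^n},$$ $$Gm_{-n}(x)=\frac{1}{2^n}\left[m_n(x)+\frac{i}{2}\,m_{n+1}(x)\right].$$
   Context: Here $i$ is the imaginary unit, and $x$ is the polynomial variable (it may be read as an arbitrary complex number, with a fixed choice of square root $\sqrt{9x^2-8}$). The Mersenne Lucas polynomials are defined by $m_0(x)=2$, $m_1(x)=3x$, $m_n(x)=3x\,m_{n-1}(x)-2m_{n-2}(x)$ for $n\ge2$. With $\lambda_1=\frac{3x+\sqrt{9x^2-8}}{2}$ and $\lambda_2=\frac{3x-\sqrt{9x^2-8}}{2}$ (the roots of $\lambda^2-3x\lambda+2=0$), they satisfy the Binet formula $m_n(x)=\lambda_1^n+\lambda_2^n$, and they are extended to negative indices by replacing $n$ with $-n$ in this formula, i.e. $m_{-n}(x)=\lambda_1^{-n}+\lambda_2^{-n}$ for $n\ge1$. The Gaussian Mersenne Lucas polynomials are defined by $Gm_0(x)=2+\frac{3i}{2}x$, $Gm_1(x)=3x+2i$, $Gm_n(x)=3x\,Gm_{n-1}(x)-2Gm_{n-2}(x)$ for $n\ge2$; they satisfy $Gm_n(x)=m_n(x)+i\,m_{n-1}(x)$ for $n\ge1$, and they are extended to negative indices by the same relation, i.e. $Gm_{-n}(x)=m_{-n}(x)+i\,m_{-n-1}(x)$ for $n\ge1$. *)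

theory Defs
  imports Complex_Main "HOL-Computational_Algebra.Polynomial"
begin

fun mersenne_lucas :: "nat \<Rightarrow> complex poly" where
  "mersenne_lucas 0 = [:2:]"
| "mersenne_lucas (Suc 0) = [:0, 3:]"
| "mersenne_lucas (Suc (Suc n)) = [:0, 3:] * mersenne_lucas (Suc n) - 2 * mersenne_lucas n"

fun gauss_mersenne_lucas :: "nat \<Rightarrow> complex poly" where
  "gauss_mersenne_lucas 0 = [:2, 3 * \<i> / 2:]"
| "gauss_mersenne_lucas (Suc 0) = [:2 * \<i>, 3:]"
| "gauss_mersenne_lucas (Suc (Suc n)) =
     [:0, 3:] * gauss_mersenne_lucas (Suc n) - 2 * gauss_mersenne_lucas n"

text \<open>
  The parameter \<open>s\<close> is the chosen square root of \<open>9 * x\<^sup>2 - 8\<close>; it is passed explicitly so that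
  statements can be made for either choice. Under \<open>s\<^sup>2 = 9 * x\<^sup>2 - 8\<close> both roots are nonzero
  (their product is 2), so their negative integer powers are genuine inverses.
\<close>

definition lambda1 :: "complex \<Rightarrow> complex \<Rightarrow> complex" where
  "lambda1 s x = (3 * x + s) / 2"

definition lambda2 :: "complex \<Rightarrow> complex \<Rightarrow> complex" where
  "lambda2 s x = (3 * x - s) / 2"

text \<open>
  Values at \<open>x\<close> of the families extended to all integer indices. Nonnegative indices use the
  recurrences; negative indices use the Binet formula and, for the Gaussian family, the relation
  \<open>Gm\<^sub>k(x) = m\<^sub>k(x) + \<i> m\<^sub>k\<^sub>-\<^sub>1(x)\<close>.
\<close>

definition mersenne_lucas_int :: "complex \<Rightarrow> int \<Rightarrow> complex \<Rightarrow> complex" where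
  "mersenne_lucas_int s k x =
     (if k \<ge> 0 then poly (mersenne_lucas (nat k)) x
      else lambda1 s x powi k + lambda2 s x powi k)"

definition gauss_mersenne_lucas_int :: "complex \<Rightarrow> int \<Rightarrow> complex \<Rightarrow> complex" where
  "gauss_mersenne_lucas_int s k x =
     (if k \<ge> 0 then poly (gauss_mersenne_lucas (nat k)) x
      else mersenne_lucas_int s k x + \<i> * mersenne_lucas_int s (k - 1) x)"

end

theory Submission
  imports Defs
begin

text \<open>
  The two roots of \<open>\<lambda>\<^sup>2 - 3 x \<lambda> + 2 = 0\<close> have product 2, so inverting one of them amounts to
  halving the other: \<open>\<lambda>\<^sub>1\<^sup>-\<^sup>n = \<lambda>\<^sub>2\<^sup>n / 2\<^sup>n\<close>, and symmetrically. Negating the index in the Binet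
  formula therefore swaps its two summands and divides the sum by \<open>2\<^sup>n\<close>. The Gaussian identity
  is this reflection applied at the indices \<open>n\<close> and \<open>n + 1\<close>; the second one contributes the
  additional factor \<open>1/2\<close>.
\<close>

lemma lambda1_times_lambda2:
  assumes "s\<^sup>2 = 9 * x\<^sup>2 - 8"
  shows "lambda1 s x * lambda2 s x = 2"
proof -
  have "lambda1 s x * lambda2 s x = (9 * x\<^sup>2 - s\<^sup>2) / 4"
    by (simp add: lambda1_def lambda2_def field_simps power2_eq_square)
  then show ?thesis using assms by simp
qed

lemma mersenne_lucas_binet:
  assumes "s\<^sup>2 = 9 * x\<^sup>2 - 8"
  shows "poly (mersenne_lucas n) x = lambda1 s x ^ n + lambda2 s x ^ n"
proof (induction n rule: mersenne_lucas.induct)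
  case 1
  show ?case by simp
next
  case 2
  show ?case by (simp add: lambda1_def lambda2_def field_simps)
next
  case (3 n)
  let ?a = "lambda1 s x" and ?b = "lambda2 s x"
  have sum: "3 * x = ?a + ?b"
    by (simp add: lambda1_def lambda2_def field_simps)
  \<comment> \<open>Rewriting the recurrence's coefficients as the sum and product of the roots makes the
      step an identity of polynomials in the two roots.\<close>
  have "poly (mersenne_lucas (Suc (Suc n))) x
      = (3 * x) * (?a ^ Suc n + ?b ^ Suc n) - 2 * (?a ^ n + ?b ^ n)"
    using 3 by (simp add: algebra_simps)
  also have "\<dots> = (?a + ?b) * (?a ^ Suc n + ?b ^ Suc n) - (?a * ?b) * (?a ^ n + ?b ^ n)"
    by (simp only: sum lambda1_times_lambda2[OF assms])
  also have "\<dots> = ?a ^ Suc (Suc n) + ?b ^ Suc (Suc n)"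
    by (simp add: algebra_simps)
  finally show ?case .
qed

lemma mersenne_lucas_int_neg:
  assumes "s\<^sup>2 = 9 * x\<^sup>2 - 8" and "n > 0"
  shows "mersenne_lucas_int s (- int n) x = poly (mersenne_lucas n) x / 2 ^ n"
proof -
  let ?a = "lambda1 s x" and ?b = "lambda2 s x"
  have prod: "?a * ?b = 2"
    by (rule lambda1_times_lambda2[OF assms(1)])
  have inv_a: "inverse ?a = ?b / 2"
    by (rule inverse_unique) (simp add: prod)
  have inv_b: "inverse ?b = ?a / 2"
    by (rule inverse_unique) (simp add: prod mult.commute[of ?b])
  have "?a powi (- int n) + ?b powi (- int n) = (?b / 2) ^ n + (?a / 2) ^ n"
    by (simp only: power_int_minus power_int_of_nat flip: power_inverse inv_a inv_b)
  then show ?thesis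
    using assms(2)
    by (simp add: mersenne_lucas_int_def mersenne_lucas_binet[OF assms(1)]
        power_divide add_divide_distrib)
qed

theorem theorem8:
  fixes x s :: complex and n :: nat
  assumes "s\<^sup>2 = 9 * x\<^sup>2 - 8"
    and "n > 0"
  shows "mersenne_lucas_int s (- int n) x = poly (mersenne_lucas n) x / 2 ^ n
       \<and> gauss_mersenne_lucas_int s (- int n) x
           = 1 / 2 ^ n * (poly (mersenne_lucas n) x + \<i> / 2 * poly (mersenne_lucas (n + 1)) x)"
proof
  show m: "mersenne_lucas_int s (- int n) x = poly (mersenne_lucas n) x / 2 ^ n"
    by (rule mersenne_lucas_int_neg[OF assms])
  have "- int n - 1 = - int (n + 1)"
    by simp
  then have m': "mersenne_lucas_int s (- int n - 1) x = poly (mersenne_lucas (n + 1)) x / 2 ^ (n + 1)"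
    by (simp only:) (rule mersenne_lucas_int_neg[OF assms(1)], simp)
  have "gauss_mersenne_lucas_int s (- int n) x
      = mersenne_lucas_int s (- int n) x + \<i> * mersenne_lucas_int s (- int n - 1) x"
    using assms(2) by (simp add: gauss_mersenne_lucas_int_def)
  then show "gauss_mersenne_lucas_int s (- int n) x
      = 1 / 2 ^ n * (poly (mersenne_lucas n) x + \<i> / 2 * poly (mersenne_lucas (n + 1)) x)"
    unfolding m m' by (simp add: field_simps del: mersenne_lucas.simps)
qed

end
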